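(* Let $\mathcal{D}$ be an extriangulated category with negative first extension and let $\mathbf{t}_1\le\mathbf{t}_2\le\mathbf{t}_3$ in $\mathsf{stors}\,\mathcal{D}$. Then, for an $\mathfrak{s}$-conflation $X\to Y\to Z$ in $\mathcal{H}_{[\mathbf{t}_1,\mathbf{t}_3]}$, the following statements hold. (a) If $[\mathbf{t}_2,\mathbf{t}_3]$ is normal and $Y\in\mathcal{H}_{[\mathbf{t}_1,\mathbf{t}_2]}$, then $Z\in\mathcal{H}_{[\mathbf{t}_1,\mathbf{t}_2]}$. (b) If $[\mathbf{t}_1,\mathbf{t}_2]$ is normal and $Y\in\mathcal{H}_{[\mathbf{t}_2,\mathbf{t}_3]}$, then $X\in\mathcal{H}_{[\mathbf{t}_2,\mathbf{t}_3]}$.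
   Context: Extriangulated categories $(\mathcal{D},\mathbb{E},\mathfrak{s})$ are in the sense of Nakaoka–Palu; an $\mathfrak{s}$-conflation (= $\mathbb{E}$-triangle) is a sequence $A\to B\to C$ realizing an element of $\mathbb{E}(C,A)$. $\mathcal{D}$ has negative first extension if there are an additive bifunctor $\mathbb{E}^{-1}:\mathcal{D}^{op}\times\mathcal{D}\to\mathrm{Ab}$ and, for each $\delta\in\mathbb{E}(C,A)$, natural transformations $\delta^{-1}:\mathbb{E}^{-1}(-,C)\to\mathcal{D}(-,A)$ and $\delta_{-1}:\mathbb{E}^{-1}(A,-)\to\mathcal{D}(C,-)$ such that, for each $\mathfrak{s}$-conflation $A\to B\to C$ realizing $\delta$ and each $W\in\mathcal{D}$, the sequences $\mathbb{E}^{-1}(W,A)\to\mathbb{E}^{-1}(W,B)\to\mathbb{E}^{-1}(W,C)\xrightarrow{\delta^{-1}}\mathcal{D}(W,A)\to\mathcal{D}(W,B)$ and $\mathbb{E}^{-1}(C,W)\to\mathbb{E}^{-1}(B,W)\to\mathbb{E}^{-1}(A,W)\xrightarrow{\delta_{-1}}\mathcal{D}(C,W)\to\mathcal{D}(B,W)$ are exact. A full extension-closed subcategory of $\mathcal{D}$ inherits by restriction the structure of an extriangulated category with negative first extension (its $\mathfrak{s}$-conflations are those of $\mathcal{D}$ with all three terms in the subcategory). An $s$-torsion pair in $\mathcal{D}$ is a pair $(\mathcal{T},\mathcal{F})$ of full isomorphism-closed subcategories with $\mathcal{D}(\mathcal{T},\mathcal{F})=0$, $\mathbb{E}^{-1}(\mathcal{T},\mathcal{F})=0$,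 and such that every $D\in\mathcal{D}$ admits an $\mathfrak{s}$-conflation $T\to D\to F$ with $T\in\mathcal{T}$, $F\in\mathcal{F}$. $\mathsf{stors}\,\mathcal{D}$ is the poset of $s$-torsion pairs, with $(\mathcal{T},\mathcal{F})\le(\mathcal{T}',\mathcal{F}')$ iff $\mathcal{T}\subseteq\mathcal{T}'$. For $\mathbf{t}_i=(\mathcal{T}_i,\mathcal{F}_i)\le\mathbf{t}_j=(\mathcal{T}_j,\mathcal{F}_j)$, the heart of the interval $[\mathbf{t}_i,\mathbf{t}_j]$ is the extension-closed subcategory $\mathcal{H}_{[\mathbf{t}_i,\mathbf{t}_j]}=\mathcal{F}_i\cap\mathcal{T}_j$, and the interval is normal if $\mathbb{E}^{-1}(\mathcal{T}_j,\mathcal{F}_i)=0$. *)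

theory Defs
  imports "HOL-Algebra.Elementary_Groups"
begin

text \<open>
  Abelian groups are the \<open>comm_group\<close>s of HOL-Algebra and are therefore written
  multiplicatively: \<open>\<otimes>\<close> is the addition and \<open>\<one>\<close> is the zero element of a Hom-group or
  of a group of extensions.
\<close>

section \<open>Additive categories\<close>

text \<open>
  The composition \<open>g \<cdot> f\<close> means ``first \<open>f\<close>, then \<open>g\<close>''. Composition does not carry its three
  objects as arguments; this loses nothing, since Hom-sets can always be made pairwise disjoint;
  disjointness is not assumed.
\<close>

record ('o, 'm) cat =
  Obj :: "'o set"
  Hom :: "'o \<Rightarrow> 'o \<Rightarrow> 'm monoid"
  Comp :: "'m \<Rightarrow> 'm \<Rightarrow> 'm"  (infixl "\<cdot>\<index>" 75)
  Ident :: "'o \<Rightarrow> 'm"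

locale preadditive_category =
  fixes \<D> :: "('o, 'm, 'z) cat_scheme" (structure)
  assumes Hom_comm_group:
      "\<lbrakk>A \<in> Obj \<D>; B \<in> Obj \<D>\<rbrakk> \<Longrightarrow> comm_group (Hom \<D> A B)"
    and Ident_in: "A \<in> Obj \<D> \<Longrightarrow> Ident \<D> A \<in> carrier (Hom \<D> A A)"
    and Comp_in:
      "\<lbrakk>A \<in> Obj \<D>; B \<in> Obj \<D>; C \<in> Obj \<D>; f \<in> carrier (Hom \<D> A B); g \<in> carrier (Hom \<D> B C)\<rbrakk>
        \<Longrightarrow> g \<cdot> f \<in> carrier (Hom \<D> A C)"
    and Comp_Ident:
      "\<lbrakk>A \<in> Obj \<D>; B \<in> Obj \<D>; f \<in> carrier (Hom \<D> A B)\<rbrakk> \<Longrightarrow> f \<cdot> Ident \<D> A = f"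
    and Ident_Comp:
      "\<lbrakk>A \<in> Obj \<D>; B \<in> Obj \<D>; f \<in> carrier (Hom \<D> A B)\<rbrakk> \<Longrightarrow> Ident \<D> B \<cdot> f = f"
    and Comp_assoc:
      "\<lbrakk>A \<in> Obj \<D>; B \<in> Obj \<D>; C \<in> Obj \<D>; E \<in> Obj \<D>; f \<in> carrier (Hom \<D> A B);
        g \<in> carrier (Hom \<D> B C); h \<in> carrier (Hom \<D> C E)\<rbrakk>
        \<Longrightarrow> (h \<cdot> g) \<cdot> f = h \<cdot> (g \<cdot> f)"
    and Comp_add_right:
      "\<lbrakk>A \<in> Obj \<D>; B \<in> Obj \<D>; C \<in> Obj \<D>; f \<in> carrier (Hom \<D> A B); f' \<in> carrier (Hom \<D> A B);
        g \<in> carrier (Hom \<D> B C)\<rbrakk>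
        \<Longrightarrow> g \<cdot> (f \<otimes>\<^bsub>Hom \<D> A B\<^esub> f') = (g \<cdot> f) \<otimes>\<^bsub>Hom \<D> A C\<^esub> (g \<cdot> f')"
    and Comp_add_left:
      "\<lbrakk>A \<in> Obj \<D>; B \<in> Obj \<D>; C \<in> Obj \<D>; f \<in> carrier (Hom \<D> A B); g \<in> carrier (Hom \<D> B C);
        g' \<in> carrier (Hom \<D> B C)\<rbrakk>
        \<Longrightarrow> (g \<otimes>\<^bsub>Hom \<D> B C\<^esub> g') \<cdot> f = (g \<cdot> f) \<otimes>\<^bsub>Hom \<D> A C\<^esub> (g' \<cdot> f)"

definition zero_object :: "('o, 'm, 'z) cat_scheme \<Rightarrow> 'o \<Rightarrow> bool" where
  "zero_object \<D> Z \<longleftrightarrow> Z \<in> Obj \<D> \<and>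
    (\<forall>A\<in>Obj \<D>. (\<exists>!f. f \<in> carrier (Hom \<D> A Z)) \<and> (\<exists>!f. f \<in> carrier (Hom \<D> Z A)))"

definition biproduct ::
  "('o, 'm, 'z) cat_scheme \<Rightarrow> 'o \<Rightarrow> 'o \<Rightarrow> 'o \<Rightarrow> 'm \<Rightarrow> 'm \<Rightarrow> 'm \<Rightarrow> 'm \<Rightarrow> bool" where
  "biproduct \<D> A B P i j p q \<longleftrightarrow>
    A \<in> Obj \<D> \<and> B \<in> Obj \<D> \<and> P \<in> Obj \<D> \<and>
    i \<in> carrier (Hom \<D> A P) \<and> j \<in> carrier (Hom \<D> B P) \<and>
    p \<in> carrier (Hom \<D> P A) \<and> q \<in> carrier (Hom \<D> P B) \<and>
    p \<cdot>\<^bsub>\<D>\<^esub> i = Ident \<D> A \<and> q \<cdot>\<^bsub>\<D>\<^esub> j = Ident \<D> B \<and>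
    p \<cdot>\<^bsub>\<D>\<^esub> j = \<one>\<^bsub>Hom \<D> B A\<^esub> \<and> q \<cdot>\<^bsub>\<D>\<^esub> i = \<one>\<^bsub>Hom \<D> A B\<^esub> \<and>
    (i \<cdot>\<^bsub>\<D>\<^esub> p) \<otimes>\<^bsub>Hom \<D> P P\<^esub> (j \<cdot>\<^bsub>\<D>\<^esub> q) = Ident \<D> P"

locale additive_category = preadditive_category +
  assumes zero_object_exists: "\<exists>Z. zero_object \<D> Z"
    and biproduct_exists:
      "\<lbrakk>A \<in> Obj \<D>; B \<in> Obj \<D>\<rbrakk> \<Longrightarrow> \<exists>P i j p q. biproduct \<D> A B P i j p q"

definition isomorphism :: "('o, 'm, 'z) cat_scheme \<Rightarrow> 'o \<Rightarrow> 'o \<Rightarrow> 'm \<Rightarrow> bool" where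
  "isomorphism \<D> A B f \<longleftrightarrow> A \<in> Obj \<D> \<and> B \<in> Obj \<D> \<and> f \<in> carrier (Hom \<D> A B) \<and>
    (\<exists>g\<in>carrier (Hom \<D> B A). g \<cdot>\<^bsub>\<D>\<^esub> f = Ident \<D> A \<and> f \<cdot>\<^bsub>\<D>\<^esub> g = Ident \<D> B)"

text \<open>Additive bifunctors, contravariant in the first and covariant in the second argument.\<close>

definition additive_bifunctor ::
  "('o, 'm, 'z) cat_scheme \<Rightarrow> ('o \<Rightarrow> 'o \<Rightarrow> 'e monoid) \<Rightarrow> ('m \<Rightarrow> 'm \<Rightarrow> 'e \<Rightarrow> 'e) \<Rightarrow> bool" where
  "additive_bifunctor \<D> F Fmap \<longleftrightarrow>
    (\<forall>C\<in>Obj \<D>. \<forall>A\<in>Obj \<D>. comm_group (F C A)) \<and>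
    (\<forall>C\<in>Obj \<D>. \<forall>C'\<in>Obj \<D>. \<forall>A\<in>Obj \<D>. \<forall>A'\<in>Obj \<D>.
      \<forall>c\<in>carrier (Hom \<D> C' C). \<forall>a\<in>carrier (Hom \<D> A A'). Fmap c a \<in> hom (F C A) (F C' A')) \<and>
    (\<forall>C\<in>Obj \<D>. \<forall>A\<in>Obj \<D>. \<forall>u\<in>carrier (F C A). Fmap (Ident \<D> C) (Ident \<D> A) u = u) \<and>
    (\<forall>C\<in>Obj \<D>. \<forall>C'\<in>Obj \<D>. \<forall>C''\<in>Obj \<D>. \<forall>A\<in>Obj \<D>. \<forall>A'\<in>Obj \<D>. \<forall>A''\<in>Obj \<D>.
      \<forall>c\<in>carrier (Hom \<D> C' C). \<forall>c'\<in>carrier (Hom \<D> C'' C').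
      \<forall>a\<in>carrier (Hom \<D> A A'). \<forall>a'\<in>carrier (Hom \<D> A' A''). \<forall>u\<in>carrier (F C A).
        Fmap (c \<cdot>\<^bsub>\<D>\<^esub> c') (a' \<cdot>\<^bsub>\<D>\<^esub> a) u = Fmap c' a' (Fmap c a u)) \<and>
    (\<forall>C\<in>Obj \<D>. \<forall>C'\<in>Obj \<D>. \<forall>A\<in>Obj \<D>. \<forall>A'\<in>Obj \<D>.
      \<forall>c\<in>carrier (Hom \<D> C' C). \<forall>c'\<in>carrier (Hom \<D> C' C). \<forall>a\<in>carrier (Hom \<D> A A').
      \<forall>u\<in>carrier (F C A).
        Fmap (c \<otimes>\<^bsub>Hom \<D> C' C\<^esub> c') a u = Fmap c a u \<otimes>\<^bsub>F C' A'\<^esub> Fmap c' a u) \<and>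
    (\<forall>C\<in>Obj \<D>. \<forall>C'\<in>Obj \<D>. \<forall>A\<in>Obj \<D>. \<forall>A'\<in>Obj \<D>.
      \<forall>c\<in>carrier (Hom \<D> C' C). \<forall>a\<in>carrier (Hom \<D> A A'). \<forall>a'\<in>carrier (Hom \<D> A A').
      \<forall>u\<in>carrier (F C A).
        Fmap c (a \<otimes>\<^bsub>Hom \<D> A A'\<^esub> a') u = Fmap c a u \<otimes>\<^bsub>F C' A'\<^esub> Fmap c a' u)"

section \<open>Extriangulated categories\<close>

text \<open>
  \<open>Ext \<D> C A\<close> is the group of extensions of \<open>C\<close> by \<open>A\<close> and \<open>ExtMap\<close> its action on morphisms.
  \<open>Realz \<D> C A \<delta>\<close> is the equivalence class of sequences \<open>A \<longlongrightarrow> B \<longlongrightarrow> C\<close> assigned to \<open>\<delta>\<close>, a sequence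
  with fixed ends being encoded as the triple of its middle term and its two morphisms.
\<close>

record ('o, 'm, 'e) ecat = "('o, 'm) cat" +
  Ext :: "'o \<Rightarrow> 'o \<Rightarrow> 'e monoid"
  ExtMap :: "'m \<Rightarrow> 'm \<Rightarrow> 'e \<Rightarrow> 'e"
  Realz :: "'o \<Rightarrow> 'o \<Rightarrow> 'e \<Rightarrow> ('o \<times> 'm \<times> 'm) set"

text \<open>\<open>pushf \<D> C a \<delta>\<close> and \<open>pullb \<D> A c \<delta>\<close> are usually written \<open>a\<^sub>*\<delta>\<close> and \<open>c\<^sup>*\<delta>\<close>.\<close>

definition pushf :: "('o, 'm, 'e, 'z) ecat_scheme \<Rightarrow> 'o \<Rightarrow> 'm \<Rightarrow> 'e \<Rightarrow> 'e" where
  "pushf \<D> C a = ExtMap \<D> (Ident \<D> C) a"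

definition pullb :: "('o, 'm, 'e, 'z) ecat_scheme \<Rightarrow> 'o \<Rightarrow> 'm \<Rightarrow> 'e \<Rightarrow> 'e" where
  "pullb \<D> A c = ExtMap \<D> c (Ident \<D> A)"

definition seqs :: "('o, 'm, 'z) cat_scheme \<Rightarrow> 'o \<Rightarrow> 'o \<Rightarrow> ('o \<times> 'm \<times> 'm) set" where
  "seqs \<D> A C =
    {(B, x, y). B \<in> Obj \<D> \<and> x \<in> carrier (Hom \<D> A B) \<and> y \<in> carrier (Hom \<D> B C)}"

definition seq_equiv ::
  "('o, 'm, 'z) cat_scheme \<Rightarrow> 'o \<Rightarrow> 'o \<Rightarrow> (('o \<times> 'm \<times> 'm) \<times> ('o \<times> 'm \<times> 'm)) set" where
  "seq_equiv \<D> A C =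
    {((B, x, y), (B', x', y')). (B, x, y) \<in> seqs \<D> A C \<and> (B', x', y') \<in> seqs \<D> A C \<and>
      (\<exists>b. isomorphism \<D> B B' b \<and> b \<cdot>\<^bsub>\<D>\<^esub> x = x' \<and> y' \<cdot>\<^bsub>\<D>\<^esub> b = y)}"

definition realizes ::
  "('o, 'm, 'e, 'z) ecat_scheme \<Rightarrow> 'o \<Rightarrow> 'm \<Rightarrow> 'o \<Rightarrow> 'm \<Rightarrow> 'o \<Rightarrow> 'e \<Rightarrow> bool" where
  "realizes \<D> A x B y C \<delta> \<longleftrightarrow>
    A \<in> Obj \<D> \<and> B \<in> Obj \<D> \<and> C \<in> Obj \<D> \<and>
    \<delta> \<in> carrier (Ext \<D> C A) \<and> (B, x, y) \<in> Realz \<D> C A \<delta>"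

definition conflation ::
  "('o, 'm, 'e, 'z) ecat_scheme \<Rightarrow> 'o \<Rightarrow> 'm \<Rightarrow> 'o \<Rightarrow> 'm \<Rightarrow> 'o \<Rightarrow> bool" where
  "conflation \<D> A x B y C \<longleftrightarrow> (\<exists>\<delta>. realizes \<D> A x B y C \<delta>)"

definition ext_morphism ::
  "('o, 'm, 'e, 'z) ecat_scheme \<Rightarrow> 'o \<Rightarrow> 'o \<Rightarrow> 'e \<Rightarrow> 'o \<Rightarrow> 'o \<Rightarrow> 'e \<Rightarrow> 'm \<Rightarrow> 'm \<Rightarrow> bool" where
  "ext_morphism \<D> A C \<delta> A' C' \<delta>' a c \<longleftrightarrow>
    a \<in> carrier (Hom \<D> A A') \<and> c \<in> carrier (Hom \<D> C C') \<and> pushf \<D> C a \<delta> = pullb \<D> A' c \<delta>'"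

text \<open>
  \<open>s(0) = 0\<close>: every split sequence \<open>A \<longlongrightarrow> A \<oplus> C \<longlongrightarrow> C\<close> realizes zero. As \<open>s(0)\<close> is an
  equivalence class, it is then the class of the split sequences.
\<close>

definition realz_split :: "('o, 'm, 'e, 'z) ecat_scheme \<Rightarrow> bool" where
  "realz_split \<D> \<longleftrightarrow>
    (\<forall>A C P i j p q. biproduct \<D> A C P i j p q \<longrightarrow> realizes \<D> A i P q C \<one>\<^bsub>Ext \<D> C A\<^esub>)"

text \<open>
  \<open>s(\<delta> \<oplus> \<delta>') = s(\<delta>) \<oplus> s(\<delta>')\<close>. The extension \<open>\<delta> \<oplus> \<delta>'\<close> is the element \<open>\<theta>\<close> that corresponds to
  \<open>(\<delta>, 0, 0, \<delta>')\<close> under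
  \<open>E(C \<oplus> C', A \<oplus> A') \<cong> E(C, A) \<oplus> E(C, A') \<oplus> E(C', A) \<oplus> E(C', A')\<close>.
\<close>

definition ext_direct_sum ::
  "('o, 'm, 'e, 'z) ecat_scheme \<Rightarrow> 'o \<Rightarrow> 'o \<Rightarrow> 'e \<Rightarrow> 'o \<Rightarrow> 'o \<Rightarrow> 'e
    \<Rightarrow> 'o \<Rightarrow> 'm \<Rightarrow> 'm \<Rightarrow> 'o \<Rightarrow> 'm \<Rightarrow> 'm \<Rightarrow> 'e \<Rightarrow> bool" where
  "ext_direct_sum \<D> A C \<delta> A' C' \<delta>' PA pA pA' PC iC iC' \<theta> \<longleftrightarrow>
    \<theta> \<in> carrier (Ext \<D> PC PA) \<and>
    ExtMap \<D> iC pA \<theta> = \<delta> \<and> ExtMap \<D> iC pA' \<theta> = \<one>\<^bsub>Ext \<D> C A'\<^esub> \<and>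
    ExtMap \<D> iC' pA \<theta> = \<one>\<^bsub>Ext \<D> C' A\<^esub> \<and> ExtMap \<D> iC' pA' \<theta> = \<delta>'"

definition realz_direct_sum :: "('o, 'm, 'e, 'z) ecat_scheme \<Rightarrow> bool" where
  "realz_direct_sum \<D> \<longleftrightarrow>
    (\<forall>A x B y C \<delta> A' x' B' y' C' \<delta>' PA iA iA' pA pA' PB iB iB' pB pB' PC iC iC' pC pC' \<theta>.
      realizes \<D> A x B y C \<delta> \<longrightarrow> realizes \<D> A' x' B' y' C' \<delta>' \<longrightarrow>
      biproduct \<D> A A' PA iA iA' pA pA' \<longrightarrow>
      biproduct \<D> B B' PB iB iB' pB pB' \<longrightarrow>
      biproduct \<D> C C' PC iC iC' pC pC' \<longrightarrow>
      ext_direct_sum \<D> A C \<delta> A' C' \<delta>' PA pA pA' PC iC iC' \<theta> \<longrightarrow>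
      realizes \<D> PA ((iB \<cdot>\<^bsub>\<D>\<^esub> x \<cdot>\<^bsub>\<D>\<^esub> pA) \<otimes>\<^bsub>Hom \<D> PA PB\<^esub> (iB' \<cdot>\<^bsub>\<D>\<^esub> x' \<cdot>\<^bsub>\<D>\<^esub> pA')) PB
        ((iC \<cdot>\<^bsub>\<D>\<^esub> y \<cdot>\<^bsub>\<D>\<^esub> pB) \<otimes>\<^bsub>Hom \<D> PB PC\<^esub> (iC' \<cdot>\<^bsub>\<D>\<^esub> y' \<cdot>\<^bsub>\<D>\<^esub> pB')) PC \<theta>)"

locale extriangulated_category = additive_category \<D>
  for \<D> :: "('o, 'm, 'e, 'z) ecat_scheme" (structure) +
  assumes ET1: "additive_bifunctor \<D> (Ext \<D>) (ExtMap \<D>)"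
    and ET2_class:
      "\<lbrakk>A \<in> Obj \<D>; C \<in> Obj \<D>; \<delta> \<in> carrier (Ext \<D> C A)\<rbrakk>
        \<Longrightarrow> Realz \<D> C A \<delta> \<in> seqs \<D> A C // seq_equiv \<D> A C"
    and ET2_realization:
      "\<lbrakk>realizes \<D> A x B y C \<delta>; realizes \<D> A' x' B' y' C' \<delta>';
        ext_morphism \<D> A C \<delta> A' C' \<delta>' a c\<rbrakk>
        \<Longrightarrow> \<exists>b\<in>carrier (Hom \<D> B B'). b \<cdot> x = x' \<cdot> a \<and> y' \<cdot> b = c \<cdot> y"
    and ET2_split: "realz_split \<D>"
    and ET2_direct_sum: "realz_direct_sum \<D>"
    and ET3:
      "\<lbrakk>realizes \<D> A x B y C \<delta>; realizes \<D> A' x' B' y' C' \<delta>';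
        a \<in> carrier (Hom \<D> A A'); b \<in> carrier (Hom \<D> B B'); b \<cdot> x = x' \<cdot> a\<rbrakk>
        \<Longrightarrow> \<exists>c. ext_morphism \<D> A C \<delta> A' C' \<delta>' a c \<and> c \<cdot> y = y' \<cdot> b"
    and ET3_op:
      "\<lbrakk>realizes \<D> A x B y C \<delta>; realizes \<D> A' x' B' y' C' \<delta>';
        b \<in> carrier (Hom \<D> B B'); c \<in> carrier (Hom \<D> C C'); c \<cdot> y = y' \<cdot> b\<rbrakk>
        \<Longrightarrow> \<exists>a. ext_morphism \<D> A C \<delta> A' C' \<delta>' a c \<and> b \<cdot> x = x' \<cdot> a"
    and ET4:
      "\<lbrakk>realizes \<D> A f B f' G \<delta>; realizes \<D> B g C g' F \<delta>'\<rbrakk>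
        \<Longrightarrow> \<exists>E d e h h' \<delta>''.
              realizes \<D> A h C h' E \<delta>'' \<and>
              h = g \<cdot> f \<and> h' \<cdot> g = d \<cdot> f' \<and> e \<cdot> h' = g' \<and>
              realizes \<D> G d E e F (pushf \<D> F f' \<delta>') \<and>
              pullb \<D> A d \<delta>'' = \<delta> \<and>
              pushf \<D> E f \<delta>'' = pullb \<D> B e \<delta>'"
    and ET4_op:
      "\<lbrakk>realizes \<D> G f' A f B \<delta>; realizes \<D> F g' B g C \<delta>'\<rbrakk>
        \<Longrightarrow> \<exists>E d e h h' \<delta>''.
              realizes \<D> E h' A h C \<delta>'' \<and>
              h = g \<cdot> f \<and> h' \<cdot> d = f' \<and> f \<cdot> h' = g' \<cdot> e \<and>
              realizes \<D> G d E e F (pullb \<D> G g' \<delta>) \<and>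
              pushf \<D> C e \<delta>'' = \<delta>' \<and>
              pushf \<D> B d \<delta> = pullb \<D> E g \<delta>''"

section \<open>Negative first extensions\<close>

text \<open>
  \<open>NConn \<D> C A \<delta> W\<close> and \<open>NCoconn \<D> C A \<delta> W\<close>, for an extension \<open>\<delta>\<close> of \<open>C\<close> by \<open>A\<close>, are the components
  at \<open>W\<close> of the natural transformations \<open>\<delta>\<^sup>-\<^sup>1\<close> from \<open>E\<^sup>-\<^sup>1(-, C)\<close> to \<open>\<D>(-, A)\<close> and \<open>\<delta>\<^sub>-\<^sub>1\<close> from
  \<open>E\<^sup>-\<^sup>1(A, -)\<close> to \<open>\<D>(C, -)\<close>.
\<close>

record ('o, 'm, 'e, 'n) necat = "('o, 'm, 'e) ecat" +
  NExt :: "'o \<Rightarrow> 'o \<Rightarrow> 'n monoid"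
  NExtMap :: "'m \<Rightarrow> 'm \<Rightarrow> 'n \<Rightarrow> 'n"
  NConn :: "'o \<Rightarrow> 'o \<Rightarrow> 'e \<Rightarrow> 'o \<Rightarrow> 'n \<Rightarrow> 'm"
  NCoconn :: "'o \<Rightarrow> 'o \<Rightarrow> 'e \<Rightarrow> 'o \<Rightarrow> 'n \<Rightarrow> 'm"

text \<open>
  HOL-Algebra's \<open>exact_seq\<close> requires all groups to have elements of one type, which is not the
  case in the sequences below.
\<close>

definition exact_at ::
  "('a, 'x) monoid_scheme \<Rightarrow> ('a \<Rightarrow> 'b) \<Rightarrow> ('b, 'y) monoid_scheme \<Rightarrow> ('b \<Rightarrow> 'c)
    \<Rightarrow> ('c, 'z) monoid_scheme \<Rightarrow> bool" where
  "exact_at F f G g H \<longleftrightarrow> f \<in> hom F G \<and> g \<in> hom G H \<and> f ` carrier F = kernel G H g"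

locale neg_extriangulated_category = extriangulated_category \<D>
  for \<D> :: "('o, 'm, 'e, 'n, 'z) necat_scheme" (structure) +
  assumes NE_bifunctor: "additive_bifunctor \<D> (NExt \<D>) (NExtMap \<D>)"
    and NConn_hom:
      "\<lbrakk>A \<in> Obj \<D>; C \<in> Obj \<D>; W \<in> Obj \<D>; \<delta> \<in> carrier (Ext \<D> C A)\<rbrakk>
        \<Longrightarrow> NConn \<D> C A \<delta> W \<in> hom (NExt \<D> W C) (Hom \<D> W A)"
    and NConn_natural:
      "\<lbrakk>A \<in> Obj \<D>; C \<in> Obj \<D>; W \<in> Obj \<D>; W' \<in> Obj \<D>; \<delta> \<in> carrier (Ext \<D> C A);
        w \<in> carrier (Hom \<D> W' W); u \<in> carrier (NExt \<D> W C)\<rbrakk>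
        \<Longrightarrow> NConn \<D> C A \<delta> W' (NExtMap \<D> w (Ident \<D> C) u) = NConn \<D> C A \<delta> W u \<cdot> w"
    and NCoconn_hom:
      "\<lbrakk>A \<in> Obj \<D>; C \<in> Obj \<D>; W \<in> Obj \<D>; \<delta> \<in> carrier (Ext \<D> C A)\<rbrakk>
        \<Longrightarrow> NCoconn \<D> C A \<delta> W \<in> hom (NExt \<D> A W) (Hom \<D> C W)"
    and NCoconn_natural:
      "\<lbrakk>A \<in> Obj \<D>; C \<in> Obj \<D>; W \<in> Obj \<D>; W' \<in> Obj \<D>; \<delta> \<in> carrier (Ext \<D> C A);
        w \<in> carrier (Hom \<D> W W'); u \<in> carrier (NExt \<D> A W)\<rbrakk>
        \<Longrightarrow> NCoconn \<D> C A \<delta> W' (NExtMap \<D> (Ident \<D> A) w u) = w \<cdot> NCoconn \<D> C A \<delta> W u"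
    and NE_exact_covariant:
      "\<lbrakk>realizes \<D> A x B y C \<delta>; W \<in> Obj \<D>\<rbrakk> \<Longrightarrow>
        exact_at (NExt \<D> W A) (NExtMap \<D> (Ident \<D> W) x)
                 (NExt \<D> W B) (NExtMap \<D> (Ident \<D> W) y) (NExt \<D> W C) \<and>
        exact_at (NExt \<D> W B) (NExtMap \<D> (Ident \<D> W) y)
                 (NExt \<D> W C) (NConn \<D> C A \<delta> W) (Hom \<D> W A) \<and>
        exact_at (NExt \<D> W C) (NConn \<D> C A \<delta> W)
                 (Hom \<D> W A) (\<lambda>f. x \<cdot> f) (Hom \<D> W B)"
    and NE_exact_contravariant:
      "\<lbrakk>realizes \<D> A x B y C \<delta>; W \<in> Obj \<D>\<rbrakk> \<Longrightarrow>
        exact_at (NExt \<D> C W) (NExtMap \<D> y (Ident \<D> W))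
                 (NExt \<D> B W) (NExtMap \<D> x (Ident \<D> W)) (NExt \<D> A W) \<and>
        exact_at (NExt \<D> B W) (NExtMap \<D> x (Ident \<D> W))
                 (NExt \<D> A W) (NCoconn \<D> C A \<delta> W) (Hom \<D> C W) \<and>
        exact_at (NExt \<D> A W) (NCoconn \<D> C A \<delta> W)
                 (Hom \<D> C W) (\<lambda>f. f \<cdot> y) (Hom \<D> B W)"

section \<open>Torsion pairs\<close>

text \<open>Full subcategories are given by their sets of objects.\<close>

definition iso_closed :: "('o, 'm, 'z) cat_scheme \<Rightarrow> 'o set \<Rightarrow> bool" where
  "iso_closed \<D> S \<longleftrightarrow> S \<subseteq> Obj \<D> \<and> (\<forall>A B f. A \<in> S \<and> isomorphism \<D> A B f \<longrightarrow> B \<in> S)"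

text \<open>
  The structure of \<open>\<D>\<close> restricted to a full subcategory. If \<open>S\<close> is closed under isomorphisms and
  extensions, all sequences in \<open>Realz \<D> C A \<delta>\<close> with \<open>A\<close> and \<open>C\<close> in \<open>S\<close> lie in \<open>S\<close>, so that only
  the set of objects has to be changed.
\<close>

definition full_subcategory ::
  "('o, 'm, 'e, 'n, 'z) necat_scheme \<Rightarrow> 'o set \<Rightarrow> ('o, 'm, 'e, 'n, 'z) necat_scheme" where
  "full_subcategory \<D> S = \<D>\<lparr>Obj := S\<rparr>"

lemma conflation_full_subcategory:
  assumes "S \<subseteq> Obj \<D>"
  shows "conflation (full_subcategory \<D> S) X x Y y Z \<longleftrightarrow>
    conflation \<D> X x Y y Z \<and> X \<in> S \<and> Y \<in> S \<and> Z \<in> S"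
  using assms by (auto simp: conflation_def realizes_def full_subcategory_def)

definition s_torsion_pair ::
  "('o, 'm, 'e, 'n, 'z) necat_scheme \<Rightarrow> 'o set \<times> 'o set \<Rightarrow> bool" where
  "s_torsion_pair \<D> = (\<lambda>(\<T>, \<F>).
    iso_closed \<D> \<T> \<and> iso_closed \<D> \<F> \<and>
    (\<forall>T\<in>\<T>. \<forall>F\<in>\<F>. trivial_group (Hom \<D> T F)) \<and>
    (\<forall>T\<in>\<T>. \<forall>F\<in>\<F>. trivial_group (NExt \<D> T F)) \<and>
    (\<forall>A\<in>Obj \<D>. \<exists>T\<in>\<T>. \<exists>F\<in>\<F>. \<exists>x y. conflation \<D> T x A y F))"

definition stors :: "('o, 'm, 'e, 'n, 'z) necat_scheme \<Rightarrow> ('o set \<times> 'o set) set" where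
  "stors \<D> = {t. s_torsion_pair \<D> t}"

definition stors_le :: "'o set \<times> 'o set \<Rightarrow> 'o set \<times> 'o set \<Rightarrow> bool" where
  "stors_le t t' \<longleftrightarrow> fst t \<subseteq> fst t'"

definition heart :: "'o set \<times> 'o set \<Rightarrow> 'o set \<times> 'o set \<Rightarrow> 'o set" where
  "heart t t' = snd t \<inter> fst t'"

definition normal_interval ::
  "('o, 'm, 'e, 'n, 'z) necat_scheme \<Rightarrow> 'o set \<times> 'o set \<Rightarrow> 'o set \<times> 'o set \<Rightarrow> bool" where
  "normal_interval \<D> t t' \<longleftrightarrow> (\<forall>T\<in>fst t'. \<forall>F\<in>snd t. trivial_group (NExt \<D> T F))"

end

theory Submission
  imports Defs
begin

text \<open>
  For an \<open>s\<close>-torsion pair \<open>(\<T>, \<F>)\<close> the vanishing of \<open>\<D>(\<T>, \<F>)\<close> alone recovers each class from the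
  other: if \<open>\<D>(A, \<F>) = 0\<close> and \<open>T \<longlongrightarrow> A \<longlongrightarrow> F\<close> is a conflation, then the second map is zero, so the
  identity of \<open>A\<close> factors through \<open>T\<close>; as \<open>E\<^sup>-\<^sup>1(T, F) = 0\<close> makes \<open>\<D>(T, T) \<longlongrightarrow> \<D>(T, A)\<close> injective,
  \<open>T \<longlongrightarrow> A\<close> is an isomorphism. Hence for (a) one has to show \<open>\<D>(Z, F) = 0\<close> for \<open>F \<in> \<F>\<^sub>2\<close>, which
  follows from the exact sequence \<open>E\<^sup>-\<^sup>1(X, F) \<longlongrightarrow> \<D>(Z, F) \<longlongrightarrow> \<D>(Y, F)\<close>, whose outer terms vanish
  by normality and by \<open>Y \<in> \<T>\<^sub>2\<close>. Part (b) is dual.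
\<close>

lemma trivial_groupD: "\<lbrakk>trivial_group G; u \<in> carrier G\<rbrakk> \<Longrightarrow> u = \<one>\<^bsub>G\<^esub>"
  by (auto simp: trivial_group_def)

section \<open>Zero morphisms, zero objects and biproducts\<close>

context preadditive_category
begin

lemma Hom_group: "\<lbrakk>A \<in> Obj \<D>; B \<in> Obj \<D>\<rbrakk> \<Longrightarrow> group (Hom \<D> A B)"
  using Hom_comm_group comm_group.axioms(2) by blast

lemma Hom_one_closed: "\<lbrakk>A \<in> Obj \<D>; B \<in> Obj \<D>\<rbrakk> \<Longrightarrow> \<one>\<^bsub>Hom \<D> A B\<^esub> \<in> carrier (Hom \<D> A B)"
  by (meson Hom_group group.is_monoid monoid.one_closed)

lemma postcomp_group_hom:
  assumes "A \<in> Obj \<D>" "B \<in> Obj \<D>" "C \<in> Obj \<D>" "g \<in> carrier (Hom \<D> B C)"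
  shows "group_hom (Hom \<D> A B) (Hom \<D> A C) (\<lambda>f. g \<cdot> f)"
  using assms
  by (auto simp: group_hom_def group_hom_axioms_def hom_def Hom_group Comp_in Comp_add_right)

lemma precomp_group_hom:
  assumes "A \<in> Obj \<D>" "B \<in> Obj \<D>" "C \<in> Obj \<D>" "f \<in> carrier (Hom \<D> A B)"
  shows "group_hom (Hom \<D> B C) (Hom \<D> A C) (\<lambda>g. g \<cdot> f)"
  using assms
  by (auto simp: group_hom_def group_hom_axioms_def hom_def Hom_group Comp_in Comp_add_left)

lemma Comp_zero:
  assumes "A \<in> Obj \<D>" "B \<in> Obj \<D>" "C \<in> Obj \<D>" "g \<in> carrier (Hom \<D> B C)"
  shows "g \<cdot> \<one>\<^bsub>Hom \<D> A B\<^esub> = \<one>\<^bsub>Hom \<D> A C\<^esub>"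
  using group_hom.hom_one[OF postcomp_group_hom[OF assms]] .

lemma zero_Comp:
  assumes "A \<in> Obj \<D>" "B \<in> Obj \<D>" "C \<in> Obj \<D>" "f \<in> carrier (Hom \<D> A B)"
  shows "\<one>\<^bsub>Hom \<D> B C\<^esub> \<cdot> f = \<one>\<^bsub>Hom \<D> A C\<^esub>"
  using group_hom.hom_one[OF precomp_group_hom[OF assms]] .

lemma zero_object_unique:
  assumes "zero_object \<D> N" "A \<in> Obj \<D>"
  shows "f \<in> carrier (Hom \<D> A N) \<Longrightarrow> f = \<one>\<^bsub>Hom \<D> A N\<^esub>"
    and "g \<in> carrier (Hom \<D> N A) \<Longrightarrow> g = \<one>\<^bsub>Hom \<D> N A\<^esub>"
  using assms Hom_one_closed unfolding zero_object_def by blast+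

text \<open>Together with \<open>ET2_split\<close> this provides concrete conflations with a
  prescribed middle term \<open>W\<close>, used as test objects for \<open>ET3\<close> and
  \<open>ET3_op\<close>.\<close>

lemma biproduct_zero_right:
  assumes N: "zero_object \<D> N" and W: "W \<in> Obj \<D>"
  shows "biproduct \<D> W N W (Ident \<D> W) \<one>\<^bsub>Hom \<D> N W\<^esub> (Ident \<D> W) \<one>\<^bsub>Hom \<D> W N\<^esub>"
proof -
  have NO: "N \<in> Obj \<D>"
    using N by (simp add: zero_object_def)
  \<comment> \<open>A zero object has only one endomorphism, so this composite is forced to be the
    identity.\<close>
  have "\<one>\<^bsub>Hom \<D> W N\<^esub> \<cdot> \<one>\<^bsub>Hom \<D> N W\<^esub> = Ident \<D> N"
    using zero_object_unique(1)[OF N NO] Comp_in Ident_in Hom_one_closed NO W by metis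
  then show ?thesis
    using NO W unfolding biproduct_def
    by (simp add: Ident_in Hom_one_closed Comp_Ident Ident_Comp Comp_zero
        monoid.r_one[OF group.is_monoid] Hom_group)
qed

lemma biproduct_swap:
  assumes "biproduct \<D> A B P i j p q"
  shows "biproduct \<D> B A P j i q p"
proof -
  have "comm_group (Hom \<D> P P)" "i \<cdot> p \<in> carrier (Hom \<D> P P)" "j \<cdot> q \<in> carrier (Hom \<D> P P)"
    using assms Hom_comm_group Comp_in by (auto simp: biproduct_def)
  then have "(j \<cdot> q) \<otimes>\<^bsub>Hom \<D> P P\<^esub> (i \<cdot> p) = (i \<cdot> p) \<otimes>\<^bsub>Hom \<D> P P\<^esub> (j \<cdot> q)"
    by (simp add: comm_group_def comm_monoid.m_comm)
  then show ?thesis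
    using assms by (simp add: biproduct_def)
qed

end

section \<open>Weak kernels and weak cokernels in conflations\<close>

context extriangulated_category
begin

text \<open>The typing of \<open>x\<close> and \<open>y\<close> comes from \<open>ET2_class\<close>:
  \<open>Realz\<close> yields a class of \<open>seq_equiv\<close>, and that relation holds only
  between members of \<open>seqs\<close>.\<close>

lemma realizes_in:
  assumes "realizes \<D> A x B y C \<delta>"
  shows "A \<in> Obj \<D>" "B \<in> Obj \<D>" "C \<in> Obj \<D>" "\<delta> \<in> carrier (Ext \<D> C A)"
    and "x \<in> carrier (Hom \<D> A B)" "y \<in> carrier (Hom \<D> B C)"
proof -
  show *: "A \<in> Obj \<D>" "B \<in> Obj \<D>" "C \<in> Obj \<D>" "\<delta> \<in> carrier (Ext \<D> C A)"
    using assms by (auto simp: realizes_def)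
  have "(B, x, y) \<in> Realz \<D> C A \<delta>"
    using assms by (simp add: realizes_def)
  moreover have "Realz \<D> C A \<delta> \<subseteq> seqs \<D> A C"
    using ET2_class[OF *(1,3,4)] by (auto simp: quotient_def seq_equiv_def)
  ultimately show "x \<in> carrier (Hom \<D> A B)" "y \<in> carrier (Hom \<D> B C)"
    by (auto simp: seqs_def)
qed

text \<open>
  The next two lemmas compare a conflation with the split conflations \<open>W \<longlongrightarrow> W \<longlongrightarrow> 0\<close> and
  \<open>0 \<longlongrightarrow> W \<longlongrightarrow> W\<close>.
\<close>

lemma realizes_weak_kernel:
  assumes r: "realizes \<D> A x B y C \<delta>" and W: "W \<in> Obj \<D>"
    and b: "b \<in> carrier (Hom \<D> W B)" and yb: "y \<cdot> b = \<one>\<^bsub>Hom \<D> W C\<^esub>"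
  shows "\<exists>a\<in>carrier (Hom \<D> W A). x \<cdot> a = b"
proof -
  note in_D = realizes_in[OF r]
  obtain N where N: "zero_object \<D> N"
    using zero_object_exists by blast
  then have NO: "N \<in> Obj \<D>"
    by (simp add: zero_object_def)
  have split: "realizes \<D> W (Ident \<D> W) W \<one>\<^bsub>Hom \<D> W N\<^esub> N \<one>\<^bsub>Ext \<D> N W\<^esub>"
    using ET2_split biproduct_zero_right[OF N W] unfolding realz_split_def by blast
  \<comment> \<open>With zero as the map on third terms, \<open>b\<close> gives the right-hand
    square of a morphism out of the split conflation; \<open>ET3_op\<close> then supplies the map on
    first terms.\<close>
  have "\<one>\<^bsub>Hom \<D> N C\<^esub> \<cdot> \<one>\<^bsub>Hom \<D> W N\<^esub> = y \<cdot> b"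
    using zero_Comp Hom_one_closed W NO in_D yb by simp
  from ET3_op[OF split r b Hom_one_closed[OF NO in_D(3)] this]
  obtain a where "a \<in> carrier (Hom \<D> W A)" "b \<cdot> Ident \<D> W = x \<cdot> a"
    unfolding ext_morphism_def by blast
  then show ?thesis
    using Comp_Ident[OF W in_D(2) b] by auto
qed

lemma realizes_weak_cokernel:
  assumes r: "realizes \<D> A x B y C \<delta>" and W: "W \<in> Obj \<D>"
    and b: "b \<in> carrier (Hom \<D> B W)" and bx: "b \<cdot> x = \<one>\<^bsub>Hom \<D> A W\<^esub>"
  shows "\<exists>c\<in>carrier (Hom \<D> C W). c \<cdot> y = b"
proof -
  note in_D = realizes_in[OF r]
  obtain N where N: "zero_object \<D> N"
    using zero_object_exists by blast
  then have NO: "N \<in> Obj \<D>"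
    by (simp add: zero_object_def)
  have split: "realizes \<D> N \<one>\<^bsub>Hom \<D> N W\<^esub> W (Ident \<D> W) W \<one>\<^bsub>Ext \<D> W N\<^esub>"
    using ET2_split biproduct_swap[OF biproduct_zero_right[OF N W]]
    unfolding realz_split_def by blast
  \<comment> \<open>The left-hand square of a morphism into the split conflation, which
    \<open>ET3\<close> completes on third terms.\<close>
  have "b \<cdot> x = \<one>\<^bsub>Hom \<D> N W\<^esub> \<cdot> \<one>\<^bsub>Hom \<D> A N\<^esub>"
    using zero_Comp Hom_one_closed W NO in_D bx by simp
  from ET3[OF r split Hom_one_closed[OF in_D(1) NO] b this]
  obtain c where "c \<in> carrier (Hom \<D> C W)" "c \<cdot> y = Ident \<D> W \<cdot> b"
    unfolding ext_morphism_def by blast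
  then show ?thesis
    using Ident_Comp[OF in_D(2) W b] by auto
qed

end

section \<open>Cancellation from vanishing negative extensions\<close>

context neg_extriangulated_category
begin

text \<open>By exactness the kernel is the image of the connecting map \<open>NConn\<close>, which
  is zero because its source is. Inflations need not be monic, so this is left cancellation for the
  test object \<open>W\<close> only.\<close>

lemma inj_on_inflation_postcomp:
  assumes r: "realizes \<D> A x B y C \<delta>" and W: "W \<in> Obj \<D>"
    and triv: "trivial_group (NExt \<D> W C)"
  shows "inj_on (\<lambda>f. x \<cdot> f) (carrier (Hom \<D> W A))"
proof -
  note in_D = realizes_in[OF r]
  interpret h: group_hom "Hom \<D> W A" "Hom \<D> W B" "\<lambda>f. x \<cdot> f"
    using postcomp_group_hom[OF W in_D(1,2,5)] .
  have conn: "group_hom (NExt \<D> W C) (Hom \<D> W A) (NConn \<D> C A \<delta> W)"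
    using triv NConn_hom[OF in_D(1,3) W in_D(4)]
    by (simp add: group_hom_def group_hom_axioms_def trivial_group_def)
  have "kernel (Hom \<D> W A) (Hom \<D> W B) (\<lambda>f. x \<cdot> f)
      = NConn \<D> C A \<delta> W ` carrier (NExt \<D> W C)"
    using NE_exact_covariant[OF r W] by (simp add: exact_at_def)
  also have "\<dots> = {\<one>\<^bsub>Hom \<D> W A\<^esub>}"
    using triv group_hom.hom_one[OF conn] by (simp add: trivial_group_def)
  finally show ?thesis
    using h.inj_iff_trivial_ker by simp
qed

text \<open>Dual argument, with the kernel now being the image of \<open>NCoconn\<close>.\<close>

lemma inj_on_deflation_precomp:
  assumes r: "realizes \<D> A x B y C \<delta>" and W: "W \<in> Obj \<D>"
    and triv: "trivial_group (NExt \<D> A W)"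
  shows "inj_on (\<lambda>f. f \<cdot> y) (carrier (Hom \<D> C W))"
proof -
  note in_D = realizes_in[OF r]
  interpret h: group_hom "Hom \<D> C W" "Hom \<D> B W" "\<lambda>f. f \<cdot> y"
    using precomp_group_hom[OF in_D(2,3) W in_D(6)] .
  have conn: "group_hom (NExt \<D> A W) (Hom \<D> C W) (NCoconn \<D> C A \<delta> W)"
    using triv NCoconn_hom[OF in_D(1,3) W in_D(4)]
    by (simp add: group_hom_def group_hom_axioms_def trivial_group_def)
  have "kernel (Hom \<D> C W) (Hom \<D> B W) (\<lambda>f. f \<cdot> y)
      = NCoconn \<D> C A \<delta> W ` carrier (NExt \<D> A W)"
    using NE_exact_contravariant[OF r W] by (simp add: exact_at_def)
  also have "\<dots> = {\<one>\<^bsub>Hom \<D> C W\<^esub>}"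
    using triv group_hom.hom_one[OF conn] by (simp add: trivial_group_def)
  finally show ?thesis
    using h.inj_iff_trivial_ker by simp
qed

text \<open>Precomposition with \<open>y\<close> is injective and lands in a zero group. In (a),
  \<open>W\<close> runs through \<open>snd t\<^sub>2\<close>.\<close>

lemma trivial_Hom_from_deflation_target:
  assumes r: "realizes \<D> X x Y y Z \<delta>" and W: "W \<in> Obj \<D>"
    and "trivial_group (NExt \<D> X W)" "trivial_group (Hom \<D> Y W)"
  shows "trivial_group (Hom \<D> Z W)"
proof -
  note in_D = realizes_in[OF r]
  interpret h: group_hom "Hom \<D> Z W" "Hom \<D> Y W" "\<lambda>f. f \<cdot> y"
    using precomp_group_hom[OF in_D(2,3) W in_D(6)] .
  have "f = \<one>\<^bsub>Hom \<D> Z W\<^esub>" if f: "f \<in> carrier (Hom \<D> Z W)" for f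
  proof (rule inj_onD[OF inj_on_deflation_precomp[OF r W assms(3)] _ f h.G.one_closed])
    show "f \<cdot> y = \<one>\<^bsub>Hom \<D> Z W\<^esub> \<cdot> y"
      using trivial_groupD[OF assms(4) h.hom_closed[OF f]] by simp
  qed
  then show ?thesis
    unfolding trivial_group_def using h.G.is_group h.G.one_closed by blast
qed

text \<open>Dual argument for (b), where \<open>W\<close> runs through
  \<open>fst t\<^sub>2\<close>.\<close>

lemma trivial_Hom_to_inflation_source:
  assumes r: "realizes \<D> X x Y y Z \<delta>" and W: "W \<in> Obj \<D>"
    and "trivial_group (NExt \<D> W Z)" "trivial_group (Hom \<D> W Y)"
  shows "trivial_group (Hom \<D> W X)"
proof -
  note in_D = realizes_in[OF r]
  interpret h: group_hom "Hom \<D> W X" "Hom \<D> W Y" "\<lambda>f. x \<cdot> f"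
    using postcomp_group_hom[OF W in_D(1,2,5)] .
  have "f = \<one>\<^bsub>Hom \<D> W X\<^esub>" if f: "f \<in> carrier (Hom \<D> W X)" for f
  proof (rule inj_onD[OF inj_on_inflation_postcomp[OF r W assms(3)] _ f h.G.one_closed])
    show "x \<cdot> f = x \<cdot> \<one>\<^bsub>Hom \<D> W X\<^esub>"
      using trivial_groupD[OF assms(4) h.hom_closed[OF f]] by simp
  qed
  then show ?thesis
    unfolding trivial_group_def using h.G.is_group h.G.one_closed by blast
qed

lemma inflation_isomorphism:
  assumes r: "realizes \<D> T x A y F \<delta>" and triv: "trivial_group (NExt \<D> T F)"
    and y0: "y = \<one>\<^bsub>Hom \<D> A F\<^esub>"
  shows "isomorphism \<D> T A x"
proof -
  note in_D = realizes_in[OF r]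
  have "y \<cdot> Ident \<D> A = \<one>\<^bsub>Hom \<D> A F\<^esub>"
    using in_D y0 Comp_Ident by simp
  from realizes_weak_kernel[OF r in_D(2) Ident_in[OF in_D(2)] this]
  obtain s where s: "s \<in> carrier (Hom \<D> A T)" "x \<cdot> s = Ident \<D> A"
    by blast
  \<comment> \<open>The section \<open>s\<close> is also a left inverse: \<open>s \<cdot> x\<close>
    and the identity agree after composing with \<open>x\<close>, which can be cancelled for the
    test object \<open>T\<close>.\<close>
  have "x \<cdot> (s \<cdot> x) = (x \<cdot> s) \<cdot> x"
    using Comp_assoc[OF in_D(1,2,1,2) in_D(5) s(1) in_D(5)] by simp
  also have "\<dots> = x \<cdot> Ident \<D> T"
    using s in_D Comp_Ident Ident_Comp by simp
  finally have "s \<cdot> x = Ident \<D> T"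
    using inj_onD[OF inj_on_inflation_postcomp[OF r in_D(1) triv]] s in_D Comp_in Ident_in
    by blast
  then show ?thesis
    using s in_D by (auto simp: isomorphism_def)
qed

lemma deflation_isomorphism:
  assumes r: "realizes \<D> T x A y F \<delta>" and triv: "trivial_group (NExt \<D> T F)"
    and x0: "x = \<one>\<^bsub>Hom \<D> T A\<^esub>"
  shows "isomorphism \<D> A F y"
proof -
  note in_D = realizes_in[OF r]
  have "Ident \<D> A \<cdot> x = \<one>\<^bsub>Hom \<D> T A\<^esub>"
    using in_D x0 Ident_Comp by simp
  from realizes_weak_cokernel[OF r in_D(2) Ident_in[OF in_D(2)] this]
  obtain s where s: "s \<in> carrier (Hom \<D> F A)" "s \<cdot> y = Ident \<D> A"
    by blast
  \<comment> \<open>Here \<open>s\<close> is a retraction of \<open>y\<close>, and \<open>y\<close>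
    is cancelled on the right for the test object \<open>F\<close>.\<close>
  have "(y \<cdot> s) \<cdot> y = y \<cdot> (s \<cdot> y)"
    using Comp_assoc[OF in_D(2,3,2,3) in_D(6) s(1) in_D(6)] .
  also have "\<dots> = Ident \<D> F \<cdot> y"
    using s in_D Comp_Ident Ident_Comp by simp
  finally have "y \<cdot> s = Ident \<D> F"
    using inj_onD[OF inj_on_deflation_precomp[OF r in_D(3) triv]] s in_D Comp_in Ident_in
    by blast
  then show ?thesis
    using s in_D by (auto simp: isomorphism_def)
qed

lemma isomorphism_sym: "isomorphism \<D> A B f \<Longrightarrow> \<exists>g. isomorphism \<D> B A g"
  by (auto simp: isomorphism_def)

section \<open>Each class of a torsion pair as an orthogonal of the other\<close>

lemma stors_conflation:
  assumes t: "t \<in> stors \<D>" and A: "A \<in> Obj \<D>"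
  obtains T F x y \<delta> where "T \<in> fst t" "F \<in> snd t" "realizes \<D> T x A y F \<delta>"
    "trivial_group (NExt \<D> T F)"
proof -
  have "\<exists>T\<in>fst t. \<exists>F\<in>snd t. \<exists>x y. conflation \<D> T x A y F"
    and "\<forall>T\<in>fst t. \<forall>F\<in>snd t. trivial_group (NExt \<D> T F)"
    using t A by (auto simp: stors_def s_torsion_pair_def)
  then show thesis
    using that unfolding conflation_def by meson
qed

text \<open>Orthogonality kills the second map of the torsion conflation of \<open>A\<close>, so
  \<open>A\<close> is isomorphic to its torsion part.\<close>

lemma stors_torsion_classI:
  assumes t: "t \<in> stors \<D>" and A: "A \<in> Obj \<D>"
    and orth: "\<And>F. F \<in> snd t \<Longrightarrow> trivial_group (Hom \<D> A F)"
  shows "A \<in> fst t"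
proof -
  obtain T F x y \<delta> where c: "T \<in> fst t" "F \<in> snd t" "realizes \<D> T x A y F \<delta>"
    "trivial_group (NExt \<D> T F)"
    using stors_conflation[OF t A] .
  have "y = \<one>\<^bsub>Hom \<D> A F\<^esub>"
    using trivial_groupD[OF orth[OF c(2)] realizes_in(6)[OF c(3)]] .
  then have "isomorphism \<D> T A x"
    using inflation_isomorphism[OF c(3,4)] by blast
  moreover have "iso_closed \<D> (fst t)"
    using t by (auto simp: stors_def s_torsion_pair_def)
  ultimately show ?thesis
    using c(1) unfolding iso_closed_def by blast
qed

lemma stors_torsionfree_classI:
  assumes t: "t \<in> stors \<D>" and A: "A \<in> Obj \<D>"
    and orth: "\<And>T. T \<in> fst t \<Longrightarrow> trivial_group (Hom \<D> T A)"
  shows "A \<in> snd t"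
proof -
  obtain T F x y \<delta> where c: "T \<in> fst t" "F \<in> snd t" "realizes \<D> T x A y F \<delta>"
    "trivial_group (NExt \<D> T F)"
    using stors_conflation[OF t A] .
  have "x = \<one>\<^bsub>Hom \<D> T A\<^esub>"
    using trivial_groupD[OF orth[OF c(1)] realizes_in(5)[OF c(3)]] .
  then have "\<exists>g. isomorphism \<D> F A g"
    using deflation_isomorphism[OF c(3,4)] isomorphism_sym by blast
  moreover have "iso_closed \<D> (snd t)"
    using t by (auto simp: stors_def s_torsion_pair_def)
  ultimately show ?thesis
    using c(2) unfolding iso_closed_def by blast
qed

end

theorem proposition3p9:
  fixes \<D> :: "('o, 'm, 'e, 'n) necat"
    and t\<^sub>1 t\<^sub>2 t\<^sub>3 :: "'o set \<times> 'o set"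
    and X Y Z :: 'o and x y :: 'm
  assumes "neg_extriangulated_category \<D>"
    and "t\<^sub>1 \<in> stors \<D>" and "t\<^sub>2 \<in> stors \<D>" and "t\<^sub>3 \<in> stors \<D>"
    and "stors_le t\<^sub>1 t\<^sub>2" and "stors_le t\<^sub>2 t\<^sub>3"
    and "conflation (full_subcategory \<D> (heart t\<^sub>1 t\<^sub>3)) X x Y y Z"
  shows "(normal_interval \<D> t\<^sub>2 t\<^sub>3 \<and> Y \<in> heart t\<^sub>1 t\<^sub>2 \<longrightarrow> Z \<in> heart t\<^sub>1 t\<^sub>2) \<and>
         (normal_interval \<D> t\<^sub>1 t\<^sub>2 \<and> Y \<in> heart t\<^sub>2 t\<^sub>3 \<longrightarrow> X \<in> heart t\<^sub>2 t\<^sub>3)"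
proof -
  interpret neg_extriangulated_category \<D>
    by fact
  have classes: "fst t \<subseteq> Obj \<D>" "snd t \<subseteq> Obj \<D>"
    and orth: "\<lbrakk>T \<in> fst t; F \<in> snd t\<rbrakk> \<Longrightarrow> trivial_group (Hom \<D> T F)"
    if "t \<in> stors \<D>" for t T F
    using that by (auto simp: stors_def s_torsion_pair_def iso_closed_def)
  have "heart t\<^sub>1 t\<^sub>3 \<subseteq> Obj \<D>"
    using classes(1)[OF assms(4)] by (auto simp: heart_def)
  then obtain \<delta> where r: "realizes \<D> X x Y y Z \<delta>"
    and H: "X \<in> snd t\<^sub>1" "X \<in> fst t\<^sub>3" "Z \<in> snd t\<^sub>1" "Z \<in> fst t\<^sub>3"
    using assms(7) conflation_full_subcategory[of "heart t\<^sub>1 t\<^sub>3" \<D>]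
    by (auto simp: conflation_def heart_def)
  note in_D = realizes_in[OF r]
  have "Z \<in> heart t\<^sub>1 t\<^sub>2" if "normal_interval \<D> t\<^sub>2 t\<^sub>3" "Y \<in> heart t\<^sub>1 t\<^sub>2"
  proof -
    \<comment> \<open>\<open>Z\<close> already lies in \<open>snd t\<^sub>1\<close>, so only
      membership in \<open>fst t\<^sub>2\<close> is open. Normality applies to \<open>X\<close>
      because \<open>X \<in> fst t\<^sub>3\<close>.\<close>
    have "trivial_group (Hom \<D> Z F)" if F: "F \<in> snd t\<^sub>2" for F
    proof (rule trivial_Hom_from_deflation_target[OF r])
      show "F \<in> Obj \<D>"
        using F classes(2)[OF assms(3)] by blast
      show "trivial_group (NExt \<D> X F)"
        using \<open>normal_interval \<D> t\<^sub>2 t\<^sub>3\<close> H(2) F by (simp add: normal_interval_def)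
      show "trivial_group (Hom \<D> Y F)"
        using \<open>Y \<in> heart t\<^sub>1 t\<^sub>2\<close> F orth[OF assms(3)] by (simp add: heart_def)
    qed
    then show ?thesis
      using stors_torsion_classI[OF assms(3) in_D(3)] H(3) by (simp add: heart_def)
  qed
  moreover have "X \<in> heart t\<^sub>2 t\<^sub>3" if "normal_interval \<D> t\<^sub>1 t\<^sub>2" "Y \<in> heart t\<^sub>2 t\<^sub>3"
  proof -
    \<comment> \<open>Here \<open>X \<in> fst t\<^sub>3\<close> is known and
      \<open>X \<in> snd t\<^sub>2\<close> is open; normality applies to \<open>Z\<close> because
      \<open>Z \<in> snd t\<^sub>1\<close>.\<close>
    have "trivial_group (Hom \<D> T X)" if T: "T \<in> fst t\<^sub>2" for T
    proof (rule trivial_Hom_to_inflation_source[OF r])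
      show "T \<in> Obj \<D>"
        using T classes(1)[OF assms(3)] by blast
      show "trivial_group (NExt \<D> T Z)"
        using \<open>normal_interval \<D> t\<^sub>1 t\<^sub>2\<close> H(3) T by (simp add: normal_interval_def)
      show "trivial_group (Hom \<D> T Y)"
        using \<open>Y \<in> heart t\<^sub>2 t\<^sub>3\<close> T orth[OF assms(3)] by (simp add: heart_def)
    qed
    then show ?thesis
      using stors_torsionfree_classI[OF assms(3) in_D(1)] H(2) by (simp add: heart_def)
  qed
  ultimately show ?thesis
    by blast
qed

end
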